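(* Let $n\in\mathbb{N}$ ($n\ge1$) and let $h$ be the heat kernel associated with $\mathcal{L}$ on $\mathbb{H}^n$. Then $$\int_{\mathbb{H}^n}|\pi_{H_1}(x)|^2\,h(1,x)\,dx=4n.$$
   Context: $\mathbb{H}^n=\mathbb{R}^{2n+1}$ is the Heisenberg group with product $(x_1,\dots,x_{2n+1})(y_1,\dots,y_{2n+1})=\big(x_1+y_1,\dots,x_{2n}+y_{2n},\,x_{2n+1}+y_{2n+1}+\frac12\sum_{i=1}^n(x_iy_{i+n}-x_{i+n}y_i)\big)$. $\pi_{H_1}(x)=(x_1,\dots,x_{2n})$ and $|\cdot|$ is the Euclidean norm. Left-invariant fields: $X_j=\partial_{x_j}-\frac12x_{j+n}\partial_{x_{2n+1}}$, $Y_j=\partial_{x_{n+j}}+\frac12x_j\partial_{x_{2n+1}}$, $1\le j\le n$; $\mathcal{L}=-\sum_{j=1}^n(X_j^2+Y_j^2)$. The heat kernel $h(t,x)$ is the fundamental solution of $\partial_t+\mathcal{L}$ on $\mathbb{R}\times\mathbb{H}^n$ with $h=0$ for $t\le0$; it is non-negative and $\int_{\mathbb{H}^n}h(t,x)dx=1$ for $t>0$. $dx$ is Lebesgue measure. *)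

theory Defs
  imports "HOL-Analysis.Analysis"
begin

text \<open>
  The Heisenberg group of dimension $2n+1$, with $n$ the cardinality of the index type. A triple
  \<open>(x, y, s)\<close> stands for the point whose first $n$ coordinates are \<open>x\<close>, whose next $n$ coordinates
  are \<open>y\<close>, and whose last coordinate is \<open>s\<close>. The norm and \<open>lborel\<close> of the product type are the
  Euclidean norm and Lebesgue measure in these coordinates.
\<close>

type_synonym 'n heis = "(real^'n) \<times> (real^'n) \<times> real"

definition heis_mult :: "('n::finite) heis \<Rightarrow> 'n heis \<Rightarrow> 'n heis" where
  "heis_mult p q = (case (p, q) of ((x, y, s), (x', y', s')) \<Rightarrow>
     (x + x', y + y', s + s' + 1/2 * (\<Sum>i\<in>UNIV. x $ i * y' $ i - y $ i * x' $ i)))"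

definition proj_H1 :: "('n::finite) heis \<Rightarrow> (real^'n) \<times> (real^'n)" where
  "proj_H1 p = (case p of (x, y, s) \<Rightarrow> (x, y))"

definition field_X :: "'n::finite \<Rightarrow> ('n heis \<Rightarrow> real) \<Rightarrow> 'n heis \<Rightarrow> real" where
  "field_X j f p = (case p of (x, y, s) \<Rightarrow>
     frechet_derivative f (at p) (axis j 1, 0, 0)
       - 1/2 * y $ j * frechet_derivative f (at p) (0, 0, 1))"

definition field_Y :: "'n::finite \<Rightarrow> ('n heis \<Rightarrow> real) \<Rightarrow> 'n heis \<Rightarrow> real" where
  "field_Y j f p = (case p of (x, y, s) \<Rightarrow>
     frechet_derivative f (at p) (0, axis j 1, 0)
       + 1/2 * x $ j * frechet_derivative f (at p) (0, 0, 1))"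

definition sublaplacian :: "(('n::finite) heis \<Rightarrow> real) \<Rightarrow> 'n heis \<Rightarrow> real" where
  "sublaplacian f p = - (\<Sum>j\<in>UNIV. field_X j (field_X j f) p + field_Y j (field_Y j f) p)"

text \<open>
  The fields are the left-invariant ones: they differentiate along right translation by the
  coordinate lines through the identity.
\<close>

lemma heis_mult_X_line:
  "heis_mult (x, y, s) (r *\<^sub>R (axis j 1, 0, 0)) = (x, y, s) + r *\<^sub>R (axis j 1, 0, - (1/2 * y $ j))"
  by (simp add: heis_mult_def axis_def if_distrib sum_negf cong: if_cong)

lemma heis_mult_Y_line:
  "heis_mult (x, y, s) (r *\<^sub>R (0, axis j 1, 0)) = (x, y, s) + r *\<^sub>R (0, axis j 1, 1/2 * x $ j)"
  by (simp add: heis_mult_def axis_def if_distrib cong: if_cong)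

primrec C_k :: "nat \<Rightarrow> ('a::real_normed_vector \<Rightarrow> real) \<Rightarrow> bool" where
  "C_k 0 f \<longleftrightarrow> continuous_on UNIV f"
| "C_k (Suc k) f \<longleftrightarrow>
     (\<forall>x. f differentiable (at x)) \<and> (\<forall>v. C_k k (\<lambda>x. frechet_derivative f (at x) v))"

definition test_function :: "('a::real_normed_vector \<Rightarrow> real) \<Rightarrow> bool" where
  "test_function \<phi> \<longleftrightarrow> (\<forall>k. C_k k \<phi>) \<and> compact (closure {x. \<phi> x \<noteq> 0})"

text \<open>
  \<open>h\<close> is a fundamental solution of $\partial_t + \mathcal{L}$, i.e. $(\partial_t + \mathcal{L}) h$
  is the Dirac mass at the origin in the sense of distributions on space-time. Each $X_j$ and $Y_j$
  is formally skew-adjoint for Lebesgue measure, so the formal adjoint applied to the test function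
  is $-\partial_t + \mathcal{L}$.
\<close>

definition heat_fundamental_solution :: "(real \<Rightarrow> ('n::finite) heis \<Rightarrow> real) \<Rightarrow> bool" where
  "heat_fundamental_solution h \<longleftrightarrow>
     (\<forall>K. compact K \<longrightarrow> set_integrable lborel K (\<lambda>(t, p). h t p)) \<and>
     (\<forall>\<phi> :: real \<times> 'n heis \<Rightarrow> real. test_function \<phi> \<longrightarrow>
        (LINT (t, p)|lborel.
           h t p * (- deriv (\<lambda>\<tau>. \<phi> (\<tau>, p)) t + sublaplacian (\<lambda>q. \<phi> (t, q)) p)) = \<phi> 0)"

text \<open>
  The differential equation and the vanishing for \<open>t \<le> 0\<close> alone do not determine the heat kernel
  (one may add a null solution of Tychonoff type); positivity and unit mass exclude this.
  A fundamental solution is only determined almost everywhere as a locally integrable function;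
  since $\partial_t + \mathcal{L}$ is hypoelliptic, it has a representative that is smooth away from
  the origin, and the continuity clause selects it, so that \<open>h 1 p\<close> is meaningful.
\<close>

definition is_heat_kernel :: "(real \<Rightarrow> ('n::finite) heis \<Rightarrow> real) \<Rightarrow> bool" where
  "is_heat_kernel h \<longleftrightarrow>
     heat_fundamental_solution h \<and>
     continuous_on (- {0}) (\<lambda>(t, p). h t p) \<and>
     (\<forall>t p. t \<le> 0 \<longrightarrow> h t p = 0) \<and>
     (\<forall>t p. 0 \<le> h t p) \<and>
     (\<forall>t>0. integrable lborel (h t) \<and> (LINT p|lborel. h t p) = 1)"

end

theory Submission
  imports Defs
begin

text \<open>
  Formally the theorem is one line. With \<open>r = |\<pi>(p)|\<^sup>2 = |x|\<^sup>2 + |y|\<^sup>2\<close> one has \<open>X\<^sub>j\<^sup>2 r = Y\<^sub>j\<^sup>2 r = 2\<close>, so the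
  sub-Laplacian of \<open>r\<close> is the constant \<open>-4n\<close>. Integrating \<open>r\<close> against the heat equation and using unit
  mass, the second moment \<open>M(t)\<close> of the kernel satisfies \<open>M' = 4n\<close> and \<open>M(0) = 0\<close>, whence \<open>M(1) = 4n\<close>.

  To make this rigorous from the distributional equation, \<open>r\<close> is replaced by the truncation
  \<open>f\<^sub>c = r \<theta>(c r) \<theta>(c s)\<close> with a smooth cutoff \<open>\<theta>\<close> equal to \<open>1\<close> near \<open>0\<close> (\<open>trunc_horiz\<close>). The arguments
  \<open>c r\<close> and \<open>c s\<close> scale in the same way under the dilations of the Heisenberg group. The sub-Laplacian
  being homogeneous of degree two, its value on \<open>f\<^sub>c\<close> is \<open>-G (c r, c s)\<close> for one bounded function \<open>G\<close>
  with \<open>G (0, 0) = 4n\<close> (\<open>sublaplacian_trunc_horiz\<close>, \<open>trunc_density_bounded\<close>). As \<open>c\<close> tends to \<open>0\<close> the rate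
  \<open>G (c r, c s)\<close> is thus bounded and converges pointwise to \<open>4n\<close>, so dominated convergence applies
  against the unit mass of the kernel.

  For fixed \<open>c\<close>, testing the equation against \<open>\<eta>(t) f\<^sub>c(p)\<close> gives
  \<open>\<integral> -\<eta>'(t) (\<integral> h f\<^sub>c) dt = \<integral> \<eta>(t) (\<integral> h G) dt\<close>. Letting \<open>\<eta>\<close> approach the indicator of \<open>(0, 1]\<close> turns this into
  \<open>\<integral> h(1, p) f\<^sub>c(p) dp = \<integral>\<^sub>0\<^sup>1 (\<integral> h G) dt\<close> (\<open>truncated_moment_eq\<close>). Continuity of the kernel at positive
  times is what makes the left-hand side a value at time \<open>1\<close> itself. As \<open>c\<close> decreases to \<open>0\<close>, the right-hand
  side tends to \<open>4n\<close>, while \<open>f\<^sub>c\<close> increases to \<open>r\<close> because \<open>\<theta>\<close> decreases in the absolute value of its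
  argument. Monotone convergence concludes.

  The class \<open>C_k\<close> is defined by recursion on the Frechet derivative, so the closure properties that
  show the test functions to be admissible, and a smooth cutoff, are built first.
\<close>

section \<open>Functions of class \<open>C_k\<close>\<close>

lemma C_k_SucI:
  assumes "\<And>x. (f has_derivative f' x) (at x)" "\<And>v. C_k k (\<lambda>x. f' x v)"
  shows "C_k (Suc k) f"
proof -
  have "frechet_derivative f (at x) = f' x" for x
    using assms(1) frechet_derivative_at by metis
  then show ?thesis
    using assms by (auto simp: differentiable_def)
qed

lemma C_k_Suc_has_derivative:
  "C_k (Suc k) f \<Longrightarrow> (f has_derivative frechet_derivative f (at x)) (at x)"
  by (simp add: frechet_derivative_works)

lemma C_k_Suc_imp_C_k: "C_k (Suc k) f \<Longrightarrow> C_k k f"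
proof (induction k arbitrary: f)
  case 0
  then show ?case
    by (auto intro!: differentiable_imp_continuous_on simp: differentiable_on_def)
next
  case (Suc k)
  then show ?case
    by (metis C_k.simps(2))
qed

lemma C_k_const: "C_k k (\<lambda>x. c)"
proof (induction k arbitrary: c)
  case (Suc k)
  show ?case by (rule C_k_SucI[where f' = "\<lambda>x v. 0"]) (use Suc in auto)
qed simp

lemma C_k_add: "C_k k f \<Longrightarrow> C_k k g \<Longrightarrow> C_k k (\<lambda>x. f x + g x)"
proof (induction k arbitrary: f g)
  case 0
  then show ?case by (simp add: continuous_on_add)
next
  case (Suc k)
  show ?case
  proof (rule C_k_SucI)
    show "((\<lambda>x. f x + g x) has_derivative
        (\<lambda>v. frechet_derivative f (at x) v + frechet_derivative g (at x) v)) (at x)" for x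
      by (intro has_derivative_add C_k_Suc_has_derivative[OF Suc.prems(1)]
          C_k_Suc_has_derivative[OF Suc.prems(2)])
  qed (use Suc in auto)
qed

lemma C_k_mult: "C_k k f \<Longrightarrow> C_k k g \<Longrightarrow> C_k k (\<lambda>x. f x * g x)"
proof (induction k arbitrary: f g)
  case 0
  then show ?case by (simp add: continuous_on_mult)
next
  case (Suc k)
  show ?case
  proof (rule C_k_SucI)
    show "((\<lambda>x. f x * g x) has_derivative
        (\<lambda>v. f x * frechet_derivative g (at x) v + frechet_derivative f (at x) v * g x)) (at x)" for x
      by (intro has_derivative_mult C_k_Suc_has_derivative[OF Suc.prems(1)]
          C_k_Suc_has_derivative[OF Suc.prems(2)])
    show "C_k k (\<lambda>x. f x * frechet_derivative g (at x) v + frechet_derivative f (at x) v * g x)" for v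
      using Suc by (intro C_k_add Suc.IH C_k_Suc_imp_C_k[OF Suc.prems(1)]
          C_k_Suc_imp_C_k[OF Suc.prems(2)]) auto
  qed
qed

lemma C_k_sum: "(\<And>i. i \<in> I \<Longrightarrow> C_k k (f i)) \<Longrightarrow> C_k k (\<lambda>x. \<Sum>i\<in>I. f i x)"
  by (induction I rule: infinite_finite_induct) (auto intro: C_k_add C_k_const)

lemma C_k_bounded_linear:
  assumes "bounded_linear f"
  shows "C_k k f"
proof (cases k)
  case 0
  then show ?thesis using assms by (simp add: linear_continuous_on)
next
  case (Suc j)
  show ?thesis unfolding Suc
    by (rule C_k_SucI[where f' = "\<lambda>x. f"])
      (use assms in \<open>auto intro: bounded_linear_imp_has_derivative C_k_const\<close>)
qed

definition smooth :: "('a::real_normed_vector \<Rightarrow> real) \<Rightarrow> bool" where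
  "smooth f \<longleftrightarrow> (\<forall>k. C_k k f)"

lemma smoothI: "(\<And>k. C_k k f) \<Longrightarrow> smooth f"
  by (simp add: smooth_def)

lemma smoothD: "smooth f \<Longrightarrow> C_k k f"
  by (simp add: smooth_def)

lemma frechet_derivative_real:
  fixes f :: "real \<Rightarrow> real"
  assumes "(f has_real_derivative d) (at x)"
  shows "frechet_derivative f (at x) v = d * v"
  using frechet_derivative_at[OF assms[unfolded has_field_derivative_def]] by metis

lemma smooth_has_real_derivative:
  fixes f :: "real \<Rightarrow> real"
  assumes "smooth f"
  shows "(f has_real_derivative deriv f x) (at x)"
proof -
  have "f differentiable (at x)"
    using smoothD[OF assms, of "Suc 0"] by simp
  then show ?thesis
    using DERIV_deriv_iff_real_differentiable by blast
qed

lemma smooth_deriv: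
  fixes f :: "real \<Rightarrow> real"
  assumes "smooth f"
  shows "smooth (deriv f)"
proof (rule smoothI)
  fix k
  have "C_k k (\<lambda>x. frechet_derivative f (at x) 1)"
    using smoothD[OF assms, of "Suc k"] by simp
  moreover have "(\<lambda>x. frechet_derivative f (at x) 1) = deriv f"
    using frechet_derivative_real[OF smooth_has_real_derivative[OF assms]] by auto
  ultimately show "C_k k (deriv f)" by simp
qed

lemma smooth_continuous_on: "smooth f \<Longrightarrow> continuous_on S f"
  using smoothD[of f 0] by (auto intro: continuous_on_subset)

text \<open>
Only an outer function on the line is treated: the chain rule then produces a single product, and
the induction hypothesis applies to \<open>deriv f\<close> with the same inner function.
\<close>

lemma C_k_compose:
  fixes f :: "real \<Rightarrow> real"
  shows "smooth f \<Longrightarrow> C_k k g \<Longrightarrow> C_k k (\<lambda>x. f (g x))"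
proof (induction k arbitrary: f)
  case 0
  then show ?case
    using smooth_continuous_on[OF 0(1), of UNIV]
    by (auto intro: continuous_on_compose2[where t = UNIV])
next
  case (Suc k)
  show ?case
  proof (rule C_k_SucI)
    show "((\<lambda>x. f (g x)) has_derivative
        (\<lambda>v. deriv f (g x) * frechet_derivative g (at x) v)) (at x)" for x
      using has_derivative_compose[OF C_k_Suc_has_derivative[OF Suc.prems(2)]
          smooth_has_real_derivative[OF Suc.prems(1), unfolded has_field_derivative_def]] .
    show "C_k k (\<lambda>x. deriv f (g x) * frechet_derivative g (at x) v)" for v
    proof (rule C_k_mult)
      show "C_k k (\<lambda>x. deriv f (g x))"
        by (rule Suc.IH[OF smooth_deriv[OF Suc.prems(1)] C_k_Suc_imp_C_k[OF Suc.prems(2)]])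
      show "C_k k (\<lambda>x. frechet_derivative g (at x) v)"
        using Suc.prems(2) by simp
    qed
  qed
qed

text \<open>
Infinite differentiability by coinduction: a family of functions that contains a derivative of each
of its members consists of smooth functions. For the flat function below such a family is easy to name,
while its iterated derivatives have no simple formula.
\<close>

lemma C_k_real_coinduct:
  fixes f :: "real \<Rightarrow> real"
  assumes "f \<in> S"
    and step: "\<And>f. f \<in> S \<Longrightarrow> \<exists>f'\<in>S. \<forall>x. (f has_real_derivative f' x) (at x)"
  shows "C_k k f"
  using assms(1)
proof (induction k arbitrary: f)
  case 0
  then obtain f' where "\<And>x. (f has_real_derivative f' x) (at x)"
    using step by metis
  then show ?case
    by (auto intro!: DERIV_continuous_on)
next
  case (Suc k)
  obtain f' where f': "f' \<in> S" "\<And>x. (f has_real_derivative f' x) (at x)"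
    using step[OF Suc.prems] by auto
  show ?case
    using Suc.IH[OF f'(1)] f'(2)
    by (intro C_k_SucI[where f' = "\<lambda>x v. f' x * v"] C_k_mult C_k_const)
      (auto simp: has_field_derivative_def)
qed

lemma smooth_antiderivative:
  fixes F :: "real \<Rightarrow> real"
  assumes "\<And>x. (F has_real_derivative f x) (at x)" "smooth f"
  shows "smooth F"
proof (rule smoothI)
  fix k
  have "C_k (Suc k) F"
    using assms by (intro C_k_SucI[where f' = "\<lambda>x v. f x * v"] C_k_mult C_k_const smoothD)
      (auto simp: has_field_derivative_def)
  then show "C_k k F" by (rule C_k_Suc_imp_C_k)
qed

section \<open>A smooth step and a cutoff\<close>

text \<open>
The classical function \<open>exp (-1/x)\<close>, extended by \<open>0\<close> to the left half-line, is \<open>flat 1\<close>. A polynomial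
factor in \<open>1/x\<close> makes the family closed under differentiation.
\<close>

definition flat :: "real poly \<Rightarrow> real \<Rightarrow> real" where
  "flat p x = (if x \<le> 0 then 0 else poly p (inverse x) * exp (- inverse x))"


lemma tendsto_poly_mult_exp_minus: "((\<lambda>y. poly p y * exp (- y)) \<longlongrightarrow> 0) (at_top :: real filter)"
proof -
  have "((\<lambda>y. \<Sum>i\<le>degree p. coeff p i * (y ^ i / exp y)) \<longlongrightarrow> (\<Sum>i\<le>degree p. coeff p i * 0)) at_top"
    by (intro tendsto_intros tendsto_power_div_exp_0)
  then show ?thesis
    by (simp add: poly_altdef sum_distrib_right exp_minus divide_inverse mult.assoc)
qed

text \<open>
To the right of \<open>0\<close> the product rule gives the factor \<open>(1/x)\<^sup>2 (p - p') (1/x)\<close>. At \<open>0\<close> the difference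
quotient vanishes in the limit because, with \<open>y = 1/x\<close>, exponential decay in \<open>y\<close> beats every polynomial.
\<close>

lemma flat_has_derivative:
  "(flat p has_real_derivative flat ([:0, 0, 1:] * (p - pderiv p)) x) (at x)"
proof -
  consider "x < 0" | "x = 0" | "x > 0" by linarith
  then show ?thesis
  proof cases
    case 1
    have "eventually (\<lambda>y. flat p y = 0) (nhds x)"
      using eventually_nhds_in_open[of "{..<0}" x] 1
      by (auto elim!: eventually_mono simp: flat_def)
    then show ?thesis
      using 1 by (subst DERIV_cong_ev[OF refl _ refl, where g = "\<lambda>_. 0"]) (auto simp: flat_def)
  next
    case 3
    have "eventually (\<lambda>y. flat p y = poly p (inverse y) * exp (- inverse y)) (nhds x)"
      using eventually_nhds_in_open[of "{0<..}" x] 3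
      by (auto elim!: eventually_mono simp: flat_def)
    moreover have "((\<lambda>y. poly p (inverse y) * exp (- inverse y)) has_real_derivative
        flat ([:0, 0, 1:] * (p - pderiv p)) x) (at x)"
      using 3 by (auto intro!: derivative_eq_intros DERIV_chain2[OF poly_DERIV]
          simp: flat_def power2_eq_square algebra_simps)
    ultimately show ?thesis
      by (subst DERIV_cong_ev[OF refl _ refl]) auto
  next
    case 2
    have left: "((\<lambda>y. flat p y / y) \<longlongrightarrow> 0) (at_left 0)"
      by (rule tendsto_eventually) (auto simp: eventually_at_filter flat_def)
    have "((\<lambda>y. poly ([:0, 1:] * p) (inverse y) * exp (- inverse y)) \<longlongrightarrow> 0) (at_right (0::real))"
      using filterlim_compose[OF tendsto_poly_mult_exp_minus filterlim_inverse_at_top_right] .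
    then have right: "((\<lambda>y. flat p y / y) \<longlongrightarrow> 0) (at_right 0)"
      by (rule Lim_transform_eventually)
        (auto simp: eventually_at_filter flat_def divide_inverse)
    have "((\<lambda>y. flat p y / y) \<longlongrightarrow> 0) (at 0)"
      using left right by (simp add: filterlim_split_at)
    then show ?thesis
      using 2 by (simp add: DERIV_def flat_def)
  qed
qed

lemma smooth_flat: "smooth (flat p)"
proof (rule smoothI)
  show "C_k k (flat p)" for k
    by (rule C_k_real_coinduct[where S = "range flat"]) (use flat_has_derivative in blast)+
qed

text \<open>
The step is the normalised antiderivative of the bump \<open>exp (-1/x) exp (-1/(1-x))\<close> on \<open>(0, 1)\<close>.
\<close>

lemma smooth_step_exists:
  "\<exists>\<sigma> :: real \<Rightarrow> real. smooth \<sigma> \<and> mono \<sigma> \<and> (\<forall>x\<le>0. \<sigma> x = 0) \<and> (\<forall>x\<ge>1. \<sigma> x = 1)"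
proof -
  define B where "B x = flat 1 x * flat 1 (1 - x)" for x
  have smooth_reflect: "smooth (\<lambda>x :: real. 1 - x)"
    using C_k_add[OF C_k_const C_k_bounded_linear[OF bounded_linear_minus[OF bounded_linear_ident]]]
    by (simp add: smooth_def)
  have B: "smooth B"
    unfolding B_def
    by (intro smoothI C_k_mult C_k_compose[OF smooth_flat] smoothD[OF smooth_flat]
        smoothD[OF smooth_reflect])
  have B_pos: "B x > 0" if "0 < x" "x < 1" for x
    using that by (simp add: B_def flat_def)
  have B_nonneg: "B x \<ge> 0" for x
    by (simp add: B_def flat_def)
  have B_zero: "B x = 0" if "x \<le> 0 \<or> 1 \<le> x" for x
    using that by (auto simp: B_def flat_def)
  have "\<exists>F. \<forall>x. -\<infinity> < ereal x \<longrightarrow> ereal x < \<infinity> \<longrightarrow> (F has_vector_derivative B x) (at x)"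
    using smooth_continuous_on[OF B, of UNIV]
    by (intro einterval_antiderivative) (auto simp: continuous_on_eq_continuous_at)
  then obtain F where F: "\<And>x. (F has_real_derivative B x) (at x)"
    by (auto simp: has_real_derivative_iff_has_vector_derivative)
  have F_mono: "F x \<le> F y" if "x \<le> y" for x y
    using DERIV_nonneg_imp_nondecreasing[OF that] F B_nonneg by blast
  have F_less: "F 0 < F 1"
  proof (rule DERIV_pos_imp_increasing_open[of 0 1 F])
    show "\<exists>d. (F has_real_derivative d) (at x) \<and> 0 < d" if "0 < x" "x < 1" for x
      using F B_pos that by blast
    show "continuous_on {0..1} F"
      using F by (meson DERIV_continuous_on has_field_derivative_at_within)
  qed simp
  have F_const: "F x = F y" if "x \<le> y" "y \<le> 0 \<or> 1 \<le> x" for x y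
  proof (rule order_antisym[OF F_mono[OF that(1)]])
    have "\<exists>d. (F has_real_derivative d) (at z) \<and> d \<le> 0" if "x \<le> z" "z \<le> y" for z
      using F[of z] B_zero[of z] that \<open>y \<le> 0 \<or> 1 \<le> x\<close> by force
    then show "F y \<le> F x"
      using DERIV_nonpos_imp_nonincreasing[OF that(1)] by blast
  qed
  have F_left: "F x = F 0" if "x \<le> 0" for x
    using F_const[of x 0] that by simp
  have F_right: "F x = F 1" if "1 \<le> x" for x
    using F_const[of 1 x] that by simp
  define \<sigma> where "\<sigma> x = (F x - F 0) * inverse (F 1 - F 0)" for x
  have "smooth \<sigma>"
    unfolding \<sigma>_def diff_conv_add_uminus
    by (intro smoothI C_k_mult C_k_add C_k_const smoothD[OF smooth_antiderivative[OF F B]])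
  moreover have "mono \<sigma>"
    unfolding \<sigma>_def using F_mono F_less by (intro monoI mult_right_mono) auto
  moreover have "\<sigma> x = 0" if "x \<le> 0" for x
    by (simp add: \<sigma>_def F_left[OF that])
  moreover have "\<sigma> x = 1" if "1 \<le> x" for x
    using F_less by (simp add: \<sigma>_def F_right[OF that])
  ultimately show ?thesis
    by blast
qed

definition smooth_step :: "real \<Rightarrow> real" where
  "smooth_step = (SOME \<sigma>. smooth \<sigma> \<and> mono \<sigma> \<and> (\<forall>x\<le>0. \<sigma> x = 0) \<and> (\<forall>x\<ge>1. \<sigma> x = 1))"

lemma smooth_step_properties:
  "smooth smooth_step \<and> mono smooth_step \<and> (\<forall>x\<le>0. smooth_step x = 0) \<and> (\<forall>x\<ge>1. smooth_step x = 1)"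
  unfolding smooth_step_def by (rule someI_ex[OF smooth_step_exists])

lemma
  shows smooth_smooth_step: "smooth smooth_step"
    and mono_smooth_step: "mono smooth_step"
    and smooth_step_eq_0: "x \<le> 0 \<Longrightarrow> smooth_step x = 0"
    and smooth_step_eq_1: "x \<ge> 1 \<Longrightarrow> smooth_step x = 1"
  using smooth_step_properties by blast+

lemma smooth_step_nonneg: "0 \<le> smooth_step x"
  using monoD[OF mono_smooth_step, of "min x 0" x] by (simp add: smooth_step_eq_0)

lemma smooth_step_le_1: "smooth_step x \<le> 1"
  using monoD[OF mono_smooth_step, of x "max x 1"] by (simp add: smooth_step_eq_1)

text \<open>
Squaring the argument makes the cutoff even and decreasing in \<open>|x|\<close>; this monotonicity later makes
the truncated moments increase to the full one.
\<close>

definition cutoff :: "real \<Rightarrow> real" where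
  "cutoff x = smooth_step (2 - x * x)"

lemma smooth_cutoff: "smooth cutoff"
proof (rule smoothI)
  fix k
  have "C_k k (\<lambda>x :: real. 2 + (- 1) * (x * x))"
    by (intro C_k_add C_k_mult C_k_const C_k_bounded_linear bounded_linear_ident)
  then show "C_k k cutoff"
    unfolding cutoff_def by (intro C_k_compose[OF smooth_smooth_step]) simp
qed

lemma cutoff_eq_1: "\<bar>x\<bar> \<le> 1 \<Longrightarrow> cutoff x = 1"
  unfolding cutoff_def
  by (rule smooth_step_eq_1) (use abs_square_le_1[of x] in \<open>simp add: power2_eq_square\<close>)

lemma cutoff_eq_0: "2 \<le> \<bar>x\<bar> \<Longrightarrow> cutoff x = 0"
  unfolding cutoff_def
  by (rule smooth_step_eq_0) (use mult_mono[of 2 "\<bar>x\<bar>" 2 "\<bar>x\<bar>"] in simp)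

lemma cutoff_nonneg: "0 \<le> cutoff x"
  by (simp add: cutoff_def smooth_step_nonneg)

lemma cutoff_le_1: "cutoff x \<le> 1"
  by (simp add: cutoff_def smooth_step_le_1)

lemma cutoff_antimono: "\<bar>x\<bar> \<le> \<bar>y\<bar> \<Longrightarrow> cutoff y \<le> cutoff x"
  unfolding cutoff_def
  by (rule monoD[OF mono_smooth_step]) (use mult_mono[of "\<bar>x\<bar>" "\<bar>y\<bar>" "\<bar>x\<bar>" "\<bar>y\<bar>"] in simp)

text \<open>
The identity, cut off. Writing the truncated square norm as \<open>cutoff_id (c |\<pi>(p)|\<^sup>2) / c\<close> keeps its
derivatives under control uniformly in the truncation parameter \<open>c\<close>.
\<close>

definition cutoff_id :: "real \<Rightarrow> real" where
  "cutoff_id x = x * cutoff x"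

lemma smooth_cutoff_id: "smooth cutoff_id"
  unfolding cutoff_id_def 
  by (intro smoothI C_k_mult C_k_bounded_linear bounded_linear_ident smoothD[OF smooth_cutoff])

lemma deriv_eq_0_outside:
  fixes f :: "real \<Rightarrow> real"
  assumes "\<And>x. b < \<bar>x\<bar> \<Longrightarrow> f x = 0" "b < \<bar>x\<bar>"
  shows "deriv f x = 0"
proof -
  have "open {x :: real. b < \<bar>x\<bar>}"
    by (intro open_Collect_less continuous_intros)
  then have "eventually (\<lambda>y. f y = 0) (nhds x)"
    using assms eventually_nhds_in_open[of "{x. b < \<bar>x\<bar>}" x] by (auto elim!: eventually_mono)
  then show ?thesis
    by (subst deriv_cong_ev[where g = "\<lambda>_. 0"]) auto
qed

lemma bounded_of_support:
  fixes f :: "real \<Rightarrow> real"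
  assumes "continuous_on UNIV f" "\<And>x. b < \<bar>x\<bar> \<Longrightarrow> f x = 0"
  shows "\<exists>C\<ge>0. \<forall>x. \<bar>f x\<bar> \<le> C"
proof -
  have "compact (f ` {-b..b})"
    by (intro compact_continuous_image continuous_on_subset[OF assms(1)]) auto
  then obtain C where C: "\<And>x. x \<in> {-b..b} \<Longrightarrow> \<bar>f x\<bar> \<le> C"
    by (metis bounded_iff compact_imp_bounded imageI real_norm_def)
  have "\<bar>f x\<bar> \<le> max C 0" for x
  proof (cases "b < \<bar>x\<bar>")
    case False
    then have "x \<in> {-b..b}" by auto
    then show ?thesis using C[of x] by simp
  qed (simp add: assms(2))
  then show ?thesis by (intro exI[of _ "max C 0"]) auto
qed

lemma cutoff_id_derivs:
  shows "deriv cutoff_id 0 = 1"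
    and "2 < \<bar>x\<bar> \<Longrightarrow> deriv cutoff_id x = 0"
    and "2 < \<bar>x\<bar> \<Longrightarrow> deriv (deriv cutoff_id) x = 0"
    and "2 < \<bar>x\<bar> \<Longrightarrow> deriv (deriv cutoff) x = 0"
proof -
  have "eventually (\<lambda>y. cutoff_id y = y) (nhds 0)"
    using eventually_nhds_in_open[of "{-1<..<1}" "0 :: real"]
    by (auto elim!: eventually_mono simp: cutoff_id_def cutoff_eq_1)
  then show "deriv cutoff_id 0 = 1"
    by (subst deriv_cong_ev[where g = "\<lambda>x. x"]) auto
  show 1: "2 < \<bar>x\<bar> \<Longrightarrow> deriv cutoff_id x = 0" for x
    by (erule deriv_eq_0_outside[rotated]) (simp add: cutoff_id_def cutoff_eq_0)
  show "2 < \<bar>x\<bar> \<Longrightarrow> deriv (deriv cutoff_id) x = 0"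
    by (erule deriv_eq_0_outside[rotated]) (rule 1)
  have "2 < \<bar>x\<bar> \<Longrightarrow> deriv cutoff x = 0" for x
    by (erule deriv_eq_0_outside[rotated]) (simp add: cutoff_eq_0)
  then show "2 < \<bar>x\<bar> \<Longrightarrow> deriv (deriv cutoff) x = 0"
    by (rule deriv_eq_0_outside)
qed

section \<open>The sub-Laplacian on functions of \<open>|\<pi>(p)|\<^sup>2\<close> and the last coordinate\<close>

definition horiz :: "('n::finite) heis \<Rightarrow> real" where
  "horiz p = (norm (proj_H1 p))\<^sup>2"

definition vert :: "('n::finite) heis \<Rightarrow> real" where
  "vert p = snd (snd p)"

lemma horiz_eq_inner: "horiz p = fst p \<bullet> fst p + fst (snd p) \<bullet> fst (snd p)"
  by (cases p) (simp add: horiz_def proj_H1_def norm_prod_def power2_norm_eq_inner)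

lemma horiz_eq_sum: "horiz (x, y, s) = (\<Sum>j\<in>UNIV. x $ j * x $ j + y $ j * y $ j)"
  by (simp add: horiz_eq_inner inner_vec_def sum.distrib)

lemma horiz_nonneg: "0 \<le> horiz p"
  by (simp add: horiz_def)

lemma continuous_on_horiz: "continuous_on S (horiz :: ('n::finite) heis \<Rightarrow> real)"
  unfolding horiz_eq_inner[abs_def] by (intro continuous_intros)

lemma continuous_on_vert: "continuous_on S (vert :: ('n::finite) heis \<Rightarrow> real)"
  unfolding vert_def[abs_def] by (intro continuous_intros)

text \<open>
A crude estimate whose only purpose is to bound sets on which both arguments of the cutoffs are bounded.
\<close>

lemma norm_le_horiz_vert: "norm (p :: ('n::finite) heis) \<le> 1 + horiz p + \<bar>vert p\<bar>"
proof -
  obtain x y s where p: "p = (x, y, s)" by (cases p)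
  have "norm p \<le> norm (proj_H1 p) + \<bar>vert p\<bar>"
  proof -
    have "(norm p)\<^sup>2 = (norm (proj_H1 p))\<^sup>2 + \<bar>vert p\<bar>\<^sup>2"
      by (simp add: p proj_H1_def vert_def norm_prod_def)
    also have "\<dots> \<le> (norm (proj_H1 p) + \<bar>vert p\<bar>)\<^sup>2"
      by (simp add: power2_sum)
    finally show ?thesis by (rule power2_le_imp_le) simp
  qed
  moreover have "norm (proj_H1 p) \<le> 1 + horiz p"
  proof -
    have "0 \<le> (norm (proj_H1 p) - 1)\<^sup>2 + norm (proj_H1 p)" by simp
    then show ?thesis
      unfolding horiz_def by (simp add: power2_eq_square algebra_simps)
  qed
  ultimately show ?thesis by simp
qed

lemma bounded_linear_coord:
  "bounded_linear (\<lambda>p :: ('n::finite) heis. fst p $ j)"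
  "bounded_linear (\<lambda>p :: ('n::finite) heis. fst (snd p) $ j)"
  "bounded_linear (vert :: ('n::finite) heis \<Rightarrow> real)"
  unfolding vert_def[abs_def]
  by (intro bounded_linear_compose[OF bounded_linear_vec_nth] bounded_linear_fst
      bounded_linear_compose[OF bounded_linear_fst] bounded_linear_compose[OF bounded_linear_snd]
      bounded_linear_snd)+

lemma field_X_eq:
  assumes "(f has_derivative f') (at (x, y, s))"
  shows "field_X j f (x, y, s) = f' (axis j 1, 0, - (1/2 * y $ j))"
proof -
  interpret linear f' using assms by (rule has_derivative_linear)
  have "f' (axis j 1, 0, - (1/2 * y $ j)) = f' ((axis j 1, 0, 0) + (- (1/2 * y $ j)) *\<^sub>R (0, 0, 1))"
    by simp
  then show ?thesis
    using frechet_derivative_at[OF assms] unfolding add scale by (simp add: field_X_def)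
qed

lemma field_Y_eq:
  assumes "(f has_derivative f') (at (x, y, s))"
  shows "field_Y j f (x, y, s) = f' (0, axis j 1, 1/2 * x $ j)"
proof -
  interpret linear f' using assms by (rule has_derivative_linear)
  have "f' (0, axis j 1, 1/2 * x $ j) = f' ((0, axis j 1, 0) + (1/2 * x $ j) *\<^sub>R (0, 0, 1))"
    by simp
  then show ?thesis
    using frechet_derivative_at[OF assms] unfolding add scale by (simp add: field_Y_def)
qed

lemma has_derivative_horiz_vert:
  fixes p :: "('n::finite) heis"
  assumes "\<And>r. (a has_real_derivative a' r) (at r)" "\<And>r. (b has_real_derivative b' r) (at r)"
  shows "((\<lambda>p. a (horiz p) * b (vert p)) has_derivative
    (\<lambda>v. a (horiz p) * (b' (vert p) * snd (snd v)) +
         a' (horiz p) * (2 * (fst p \<bullet> fst v + fst (snd p) \<bullet> fst (snd v))) * b (vert p))) (at p)"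
proof (rule has_derivative_mult)
  have horiz: "(horiz has_derivative (\<lambda>v. 2 * (fst p \<bullet> fst v + fst (snd p) \<bullet> fst (snd v)))) (at p)"
    unfolding horiz_eq_inner[abs_def]
    by (auto intro!: derivative_eq_intros simp: inner_commute)
  have vert: "(vert has_derivative (\<lambda>v. snd (snd v))) (at p)"
    unfolding vert_def[abs_def] by (auto intro!: derivative_eq_intros)
  show "((\<lambda>p. a (horiz p)) has_derivative
      (\<lambda>v. a' (horiz p) * (2 * (fst p \<bullet> fst v + fst (snd p) \<bullet> fst (snd v))))) (at p)"
    using has_derivative_compose[OF horiz assms(1)[unfolded has_field_derivative_def]] .
  show "((\<lambda>p. b (vert p)) has_derivative (\<lambda>v. b' (vert p) * snd (snd v))) (at p)"
    using has_derivative_compose[OF vert assms(2)[unfolded has_field_derivative_def]] .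
qed

text \<open>
Write \<open>r = |\<pi>(p)|\<^sup>2\<close>. Since \<open>X\<^sub>j r = 2 x\<^sub>j\<close>, \<open>Y\<^sub>j r = 2 y\<^sub>j\<close>, \<open>X\<^sub>j s = - y\<^sub>j / 2\<close> and \<open>Y\<^sub>j s = x\<^sub>j / 2\<close>, the mixed
terms with \<open>a' b'\<close> carry the factor \<open>x\<^sub>j y\<^sub>j\<close> with opposite signs in \<open>X\<^sub>j\<^sup>2\<close> and \<open>Y\<^sub>j\<^sup>2\<close> and cancel. The rest
sums to a function of \<open>r\<close> and \<open>s\<close> alone.
\<close>

lemma sublaplacian_horiz_vert:
  fixes p :: "('n::finite) heis"
  assumes a: "\<And>r. (a has_real_derivative a' r) (at r)" "\<And>r. (a' has_real_derivative a'' r) (at r)"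
    and b: "\<And>r. (b has_real_derivative b' r) (at r)" "\<And>r. (b' has_real_derivative b'' r) (at r)"
  shows "sublaplacian (\<lambda>p. a (horiz p) * b (vert p)) p =
    - (4 * real CARD('n) * a' (horiz p) * b (vert p) + 4 * horiz p * a'' (horiz p) * b (vert p)
       + 1/4 * horiz p * a (horiz p) * b'' (vert p))"
proof -
  define f where "f = (\<lambda>p :: 'n heis. a (horiz p) * b (vert p))"
  obtain x y s where p: "p = (x, y, s)" by (cases p)
  have X: "field_X j f = (\<lambda>q. fst q $ j * (2 * (a' (horiz q) * b (vert q)))
      - fst (snd q) $ j * (1/2 * (a (horiz q) * b' (vert q))))" for j
  proof
    fix q :: "'n heis"
    obtain x y s where q: "q = (x, y, s)" by (cases q)
    show "field_X j f q = fst q $ j * (2 * (a' (horiz q) * b (vert q)))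
      - fst (snd q) $ j * (1/2 * (a (horiz q) * b' (vert q)))"
      unfolding q f_def field_X_eq[OF has_derivative_horiz_vert[OF a(1) b(1)]]
      by (simp add: inner_axis algebra_simps)
  qed
  have Y: "field_Y j f = (\<lambda>q. fst (snd q) $ j * (2 * (a' (horiz q) * b (vert q)))
      + fst q $ j * (1/2 * (a (horiz q) * b' (vert q))))" for j
  proof
    fix q :: "'n heis"
    obtain x y s where q: "q = (x, y, s)" by (cases q)
    show "field_Y j f q = fst (snd q) $ j * (2 * (a' (horiz q) * b (vert q)))
      + fst q $ j * (1/2 * (a (horiz q) * b' (vert q)))"
      unfolding q f_def field_Y_eq[OF has_derivative_horiz_vert[OF a(1) b(1)]]
      by (simp add: inner_axis algebra_simps)
  qed
  note D1 = has_derivative_horiz_vert[OF a(2) b(1), of p]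
    and D2 = has_derivative_horiz_vert[OF a(1) b(2), of p]
  have coord: "((\<lambda>q :: 'n heis. fst q $ j) has_derivative (\<lambda>v. fst v $ j)) (at p)"
    "((\<lambda>q :: 'n heis. fst (snd q) $ j) has_derivative (\<lambda>v. fst (snd v) $ j)) (at p)" for j
    by (intro bounded_linear_imp_has_derivative bounded_linear_coord)+
  let ?h = "horiz p"
  have XX: "field_X j (field_X j f) p = 2 * a' ?h * b s + 4 * (x $ j * x $ j) * a'' ?h * b s
      - 2 * x $ j * y $ j * a' ?h * b' s + 1/4 * (y $ j * y $ j) * a ?h * b'' s" for j
    unfolding X p
    by (subst field_X_eq[OF has_derivative_diff[OF
        has_derivative_mult[OF coord(1) has_derivative_mult_right[OF D1, of 2]]
        has_derivative_mult[OF coord(2) has_derivative_mult_right[OF D2, of "1/2"]],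
        unfolded p]])
      (simp add: inner_axis vert_def algebra_simps)
  have YY: "field_Y j (field_Y j f) p = 2 * a' ?h * b s + 4 * (y $ j * y $ j) * a'' ?h * b s
      + 2 * x $ j * y $ j * a' ?h * b' s + 1/4 * (x $ j * x $ j) * a ?h * b'' s" for j
    unfolding Y p
    by (subst field_Y_eq[OF has_derivative_add[OF
        has_derivative_mult[OF coord(2) has_derivative_mult_right[OF D1, of 2]]
        has_derivative_mult[OF coord(1) has_derivative_mult_right[OF D2, of "1/2"]],
        unfolded p]])
      (simp add: inner_axis vert_def algebra_simps)
  have "(\<Sum>j\<in>UNIV. field_X j (field_X j f) p + field_Y j (field_Y j f) p) =
    (\<Sum>j\<in>(UNIV :: 'n set). 4 * a' ?h * b s +
       (x $ j * x $ j + y $ j * y $ j) * (4 * a'' ?h * b s + 1/4 * a ?h * b'' s))"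
    by (rule sum.cong) (simp_all add: XX YY algebra_simps)
  also have "\<dots> = 4 * real CARD('n) * a' ?h * b s
      + (\<Sum>j\<in>UNIV. x $ j * x $ j + y $ j * y $ j) * (4 * a'' ?h * b s + 1/4 * a ?h * b'' s)"
    by (subst sum.distrib, subst sum_distrib_right) simp
  also have "(\<Sum>j\<in>UNIV. x $ j * x $ j + y $ j * y $ j) = ?h"
    by (simp add: p horiz_eq_sum)
  finally show ?thesis
    by (simp add: sublaplacian_def f_def p vert_def algebra_simps)
qed

section \<open>The truncated moments\<close>

text \<open>
With \<open>c = 1/R\<^sup>2\<close> this is \<open>R\<^sup>2\<close> times a fixed compactly supported function, precomposed with the group
dilation \<open>(x, y, s) \<mapsto> (x/R, y/R, s/R\<^sup>2)\<close>. The sub-Laplacian is homogeneous of degree two under these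
dilations, so the powers of \<open>R\<close> cancel in its value.
\<close>

definition trunc_horiz :: "real \<Rightarrow> ('n::finite) heis \<Rightarrow> real" where
  "trunc_horiz c p = horiz p * (cutoff (c * horiz p) * cutoff (c * vert p))"

text \<open>
The value of \<open>-\<L>\<close> on the truncated square norm; it depends on \<open>c\<close> only through the dilated
coordinates \<open>r\<close> and \<open>w\<close>.
\<close>

definition trunc_density :: "real \<Rightarrow> ('n::finite) heis \<Rightarrow> real" where
  "trunc_density c p =
     (let r = c * horiz p; w = c * vert p in
      4 * real CARD('n) * (deriv cutoff_id r * cutoff w)
      + 4 * (r * deriv (deriv cutoff_id) r * cutoff w)
      + 1/4 * (r * cutoff_id r * deriv (deriv cutoff) w))"

lemma trunc_horiz_eq: "c \<noteq> 0 \<Longrightarrow>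
    trunc_horiz c p = inverse c * cutoff_id (c * horiz p) * cutoff (c * vert p)"
  by (simp add: trunc_horiz_def cutoff_id_def)

lemma smooth_has_real_derivative_scale:
  fixes f :: "real \<Rightarrow> real"
  assumes "smooth f"
  shows "((\<lambda>r. f (c * r)) has_real_derivative c * deriv f (c * r)) (at r)"
  using DERIV_chain2[OF smooth_has_real_derivative[OF assms] DERIV_cmult_Id[of c]]
  by (simp only: mult.commute[of c "deriv f (c * r)"])

lemma sublaplacian_trunc_horiz:
  assumes "c \<noteq> 0"
  shows "sublaplacian (\<lambda>q. k * trunc_horiz c q) p = - (k * trunc_density c p)"
proof -
  note [derivative_intros] = smooth_has_real_derivative_scale[OF smooth_cutoff_id]
    smooth_has_real_derivative_scale[OF smooth_deriv[OF smooth_cutoff_id]] smooth_has_real_derivative_scale[OF smooth_cutoff]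
    smooth_has_real_derivative_scale[OF smooth_deriv[OF smooth_cutoff]]
  have eq: "(\<lambda>q. k * trunc_horiz c q) =
      (\<lambda>q. (k * inverse c * cutoff_id (c * horiz q)) * cutoff (c * vert q))"
    using assms by (simp add: trunc_horiz_eq mult.assoc)
  have "sublaplacian (\<lambda>q. k * trunc_horiz c q) p =
    - (4 * real CARD('a) * (k * deriv cutoff_id (c * horiz p)) * cutoff (c * vert p)
      + 4 * horiz p * (k * c * deriv (deriv cutoff_id) (c * horiz p)) * cutoff (c * vert p)
      + 1/4 * horiz p * (k * inverse c * cutoff_id (c * horiz p))
          * (c * c * deriv (deriv cutoff) (c * vert p)))"
    unfolding eq
  proof (rule sublaplacian_horiz_vert)
    show "((\<lambda>r. k * inverse c * cutoff_id (c * r)) has_real_derivative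
        k * deriv cutoff_id (c * r)) (at r)" for r
      using assms by (auto intro!: derivative_eq_intros)
    show "((\<lambda>r. k * deriv cutoff_id (c * r)) has_real_derivative
        k * c * deriv (deriv cutoff_id) (c * r)) (at r)" for r
      by (auto intro!: derivative_eq_intros)
    show "((\<lambda>r. cutoff (c * r)) has_real_derivative c * deriv cutoff (c * r)) (at r)" for r
      by (rule smooth_has_real_derivative_scale[OF smooth_cutoff])
    show "((\<lambda>r. c * deriv cutoff (c * r)) has_real_derivative
        c * c * deriv (deriv cutoff) (c * r)) (at r)" for r
      by (auto intro!: derivative_eq_intros)
  qed
  then show ?thesis
    using assms by (simp add: trunc_density_def Let_def field_simps)
qed

lemma trunc_horiz_bounds: "0 \<le> trunc_horiz c p" "trunc_horiz c p \<le> horiz p"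
  by (auto simp: trunc_horiz_def horiz_nonneg cutoff_nonneg cutoff_le_1 mult_le_one mult_left_le)

lemma trunc_horiz_bounded:
  assumes "c > 0"
  shows "trunc_horiz c p \<le> 2 / c"
proof (cases "2 \<le> c * horiz p")
  case True
  then show ?thesis
    using assms cutoff_eq_0[of "c * horiz p"] by (simp add: trunc_horiz_def)
next
  case False
  then have "horiz p \<le> 2 / c" using assms by (simp add: field_simps)
  then show ?thesis using trunc_horiz_bounds(2)[of c p] by linarith
qed

lemma trunc_horiz_support:
  assumes "c > 0" "trunc_horiz c p \<noteq> 0"
  shows "norm p \<le> 1 + 4 / c"
proof -
  have "\<bar>c * horiz p\<bar> < 2" "\<bar>c * vert p\<bar> < 2"
    using assms cutoff_eq_0 by (fastforce simp: trunc_horiz_def not_le[symmetric])+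
  then have "horiz p \<le> 2 / c" "\<bar>vert p\<bar> \<le> 2 / c"
    using assms horiz_nonneg[of p] by (simp_all add: field_simps abs_mult)
  then show ?thesis using norm_le_horiz_vert[of p] by simp
qed

lemma trunc_horiz_mono:
  assumes "0 < c" "c \<le> d"
  shows "trunc_horiz d p \<le> trunc_horiz c p"
  unfolding trunc_horiz_def using assms
  by (intro mult_left_mono mult_mono cutoff_antimono)
    (auto simp: abs_mult cutoff_nonneg horiz_nonneg mult_right_mono)

lemma trunc_horiz_tendsto:
  assumes "c \<longlonglongrightarrow> 0"
  shows "(\<lambda>k. trunc_horiz (c k) p) \<longlonglongrightarrow> horiz p"
proof -
  have "isCont cutoff 0"
    using smooth_continuous_on[OF smooth_cutoff, of UNIV] continuous_on_eq_continuous_at by blast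
  then have "(\<lambda>k. horiz p * (cutoff (c k * horiz p) * cutoff (c k * vert p))) \<longlonglongrightarrow>
      horiz p * (cutoff 0 * cutoff 0)"
    using tendsto_mult_left_zero[OF assms]
    by (intro tendsto_intros isCont_tendsto_compose[where g = cutoff])
  then show ?thesis
    by (simp add: trunc_horiz_def cutoff_eq_1)
qed

lemma isCont_smooth_real: "smooth f \<Longrightarrow> isCont f (x :: real)"
  using smooth_continuous_on[of f UNIV] continuous_on_eq_continuous_at by blast

lemma trunc_density_tendsto:
  fixes p :: "('n::finite) heis"
  assumes "c \<longlonglongrightarrow> 0"
  shows "(\<lambda>k. trunc_density (c k) p) \<longlonglongrightarrow> 4 * real CARD('n)"
proof -
  have scale: "(\<lambda>k. c k * z) \<longlonglongrightarrow> 0" for z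
    by (rule tendsto_mult_left_zero[OF assms])
  have lim: "(\<lambda>k. g (c k * z)) \<longlonglongrightarrow> g 0" if "smooth g" for g :: "real \<Rightarrow> real" and z
    by (rule isCont_tendsto_compose[OF isCont_smooth_real[OF that] scale])
  have "(\<lambda>k. trunc_density (c k) p) \<longlonglongrightarrow>
      4 * real CARD('n) * (deriv cutoff_id 0 * cutoff 0)
      + 4 * (0 * deriv (deriv cutoff_id) 0 * cutoff 0)
      + 1/4 * (0 * cutoff_id 0 * deriv (deriv cutoff) 0)"
    unfolding trunc_density_def Let_def
    by (intro tendsto_add tendsto_mult tendsto_const scale lim[OF smooth_cutoff]
        lim[OF smooth_cutoff_id] lim[OF smooth_deriv[OF smooth_cutoff_id]]
        lim[OF smooth_deriv[OF smooth_deriv[OF smooth_cutoff_id]]]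
        lim[OF smooth_deriv[OF smooth_deriv[OF smooth_cutoff]]])
  then show ?thesis
    by (simp add: cutoff_eq_1 cutoff_id_derivs(1))
qed

text \<open>
The bound is uniform in \<open>c\<close>: this is where the homogeneity of the truncation enters, and it is what
allows dominated convergence against a measure of mass one.
\<close>

lemma trunc_density_bounded:
  "\<exists>C\<ge>0. \<forall>c. \<forall>p :: ('n::finite) heis. \<bar>trunc_density c p\<bar> \<le> C"
proof -
  note cont = smooth_continuous_on[OF smooth_cutoff_id]
    smooth_continuous_on[OF smooth_deriv[OF smooth_cutoff_id]]
    smooth_continuous_on[OF smooth_deriv[OF smooth_deriv[OF smooth_cutoff_id]]]
    smooth_continuous_on[OF smooth_deriv[OF smooth_deriv[OF smooth_cutoff]]]
  obtain A where A: "A \<ge> 0" "\<And>r. \<bar>deriv cutoff_id r\<bar> \<le> A"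
    using bounded_of_support[of "deriv cutoff_id" 2] cont cutoff_id_derivs(2) by blast
  have "continuous_on UNIV (\<lambda>r. r * deriv (deriv cutoff_id) r)"
    by (intro continuous_intros cont)
  then obtain B where B: "B \<ge> 0" "\<And>r. \<bar>r * deriv (deriv cutoff_id) r\<bar> \<le> B"
    using bounded_of_support[of "\<lambda>r. r * deriv (deriv cutoff_id) r" 2] cutoff_id_derivs(3) by auto
  have "continuous_on UNIV (\<lambda>r. r * cutoff_id r)"
    by (intro continuous_intros cont)
  then obtain C where C: "C \<ge> 0" "\<And>r. \<bar>r * cutoff_id r\<bar> \<le> C"
    using bounded_of_support[of "\<lambda>r. r * cutoff_id r" 2] by (auto simp: cutoff_id_def cutoff_eq_0)
  obtain D where D: "D \<ge> 0" "\<And>r. \<bar>deriv (deriv cutoff) r\<bar> \<le> D"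
    using bounded_of_support[of "deriv (deriv cutoff)" 2] cont cutoff_id_derivs(4) by blast
  have cut: "\<bar>cutoff r\<bar> \<le> 1" for r
    using cutoff_nonneg[of r] cutoff_le_1[of r] by simp
  have "\<bar>trunc_density c p\<bar> \<le> 4 * real CARD('n) * (A * 1) + 4 * (B * 1) + 1/4 * (C * D)"
    for c and p :: "'n heis"
  proof -
    let ?r = "c * horiz p" and ?w = "c * vert p"
    have "\<bar>trunc_density c p\<bar> \<le> \<bar>4 * real CARD('n) * (deriv cutoff_id ?r * cutoff ?w)\<bar>
        + \<bar>4 * (?r * deriv (deriv cutoff_id) ?r * cutoff ?w)\<bar>
        + \<bar>1/4 * (?r * cutoff_id ?r * deriv (deriv cutoff) ?w)\<bar>"
      unfolding trunc_density_def Let_def by linarith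
    also have "\<dots> = 4 * real CARD('n) * (\<bar>deriv cutoff_id ?r\<bar> * \<bar>cutoff ?w\<bar>)
        + 4 * (\<bar>?r * deriv (deriv cutoff_id) ?r\<bar> * \<bar>cutoff ?w\<bar>)
        + 1/4 * (\<bar>?r * cutoff_id ?r\<bar> * \<bar>deriv (deriv cutoff) ?w\<bar>)"
      by (simp add: abs_mult)
    also have "\<dots> \<le> 4 * real CARD('n) * (A * 1) + 4 * (B * 1) + 1/4 * (C * D)"
      using A B C D cut by (intro add_mono mult_left_mono mult_mono) auto
    finally show ?thesis .
  qed
  then show ?thesis
    using A(1) B(1) C(1) D(1)
    by (intro exI[of _ "4 * real CARD('n) * (A * 1) + 4 * (B * 1) + 1/4 * (C * D)"]) auto
qed

lemma continuous_on_trunc_horiz: "continuous_on S (trunc_horiz c :: ('n::finite) heis \<Rightarrow> real)"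
  unfolding trunc_horiz_def[abs_def]
  by (intro continuous_intros continuous_on_horiz continuous_on_vert
      continuous_on_compose2[OF smooth_continuous_on[OF smooth_cutoff, of UNIV]]) auto

lemma continuous_on_trunc_density: "continuous_on S (trunc_density c :: ('n::finite) heis \<Rightarrow> real)"
proof -
  have comp: "continuous_on S (\<lambda>p. g (c * u p))"
    if "smooth g" "continuous_on S u" for g and u :: "'n heis \<Rightarrow> real"
    by (rule continuous_on_compose2[OF smooth_continuous_on[OF that(1), of UNIV]])
      (use that(2) in \<open>auto intro: continuous_on_mult_left\<close>)
  show ?thesis
    unfolding trunc_density_def[abs_def] Let_def
    by (intro continuous_on_add continuous_on_mult continuous_on_const
        continuous_on_horiz continuous_on_vert comp[OF smooth_cutoff]
        comp[OF smooth_cutoff_id] comp[OF smooth_deriv[OF smooth_cutoff_id]]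
        comp[OF smooth_deriv[OF smooth_deriv[OF smooth_cutoff_id]]]
        comp[OF smooth_deriv[OF smooth_deriv[OF smooth_cutoff]]])
qed

text \<open>
Used with the two projections of space-time, to turn functions of time or of space into functions of both.
\<close>

lemma C_k_comp_linear:
  assumes "bounded_linear L"
  shows "C_k k f \<Longrightarrow> C_k k (\<lambda>x. f (L x))"
proof (induction k arbitrary: f)
  case 0
  then show ?case
    using linear_continuous_on[OF assms, of UNIV] by (auto intro: continuous_on_compose2[where t = UNIV])
next
  case (Suc k)
  show ?case
  proof (rule C_k_SucI)
    show "((\<lambda>x. f (L x)) has_derivative (\<lambda>v. frechet_derivative f (at (L x)) (L v))) (at x)" for x
      using has_derivative_compose[OF bounded_linear_imp_has_derivative[OF assms]
          C_k_Suc_has_derivative[OF Suc.prems]] .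
    show "C_k k (\<lambda>x. frechet_derivative f (at (L x)) (L v))" for v
      using Suc.prems by (intro Suc.IH) simp
  qed
qed

lemma smooth_trunc_horiz: "smooth (trunc_horiz c :: ('n::finite) heis \<Rightarrow> real)"
proof (rule smoothI)
  fix k
  have coord: "C_k k (\<lambda>p :: 'n heis. fst p $ j)" "C_k k (\<lambda>p :: 'n heis. fst (snd p) $ j)" for j
    by (intro C_k_bounded_linear bounded_linear_coord)+
  have horiz: "C_k k (horiz :: 'n heis \<Rightarrow> real)"
    unfolding horiz_eq_inner[abs_def] inner_vec_def
    by (simp, intro C_k_add C_k_sum C_k_mult coord)
  have vert: "C_k k (vert :: 'n heis \<Rightarrow> real)"
    by (intro C_k_bounded_linear bounded_linear_coord)
  show "C_k k (trunc_horiz c :: 'n heis \<Rightarrow> real)"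
    unfolding trunc_horiz_def[abs_def]
    by (intro C_k_mult C_k_compose[OF smooth_cutoff] C_k_const horiz vert)
qed

lemma test_function_trunc_horiz:
  fixes \<eta> :: "real \<Rightarrow> real"
  assumes "smooth \<eta>" "\<And>t. b < \<bar>t\<bar> \<Longrightarrow> \<eta> t = 0" "c > 0"
  shows "test_function (\<lambda>(t, p). \<eta> t * trunc_horiz c (p :: ('n::finite) heis))"
  unfolding test_function_def
proof
  show "\<forall>k. C_k k (\<lambda>(t, p). \<eta> t * trunc_horiz c (p :: 'n heis))"
    unfolding case_prod_beta
    by (intro allI C_k_mult C_k_comp_linear[OF bounded_linear_fst] smoothD[OF assms(1)]
        C_k_comp_linear[OF bounded_linear_snd] smoothD[OF smooth_trunc_horiz])
  have "{(t, p). \<eta> t * trunc_horiz c (p :: 'n heis) \<noteq> 0} \<subseteq> cball 0 b \<times> cball 0 (1 + 4 / c)"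
  proof
    fix z :: "real \<times> 'n heis"
    obtain t p where z: "z = (t, p)" by (cases z)
    assume "z \<in> {(t, p). \<eta> t * trunc_horiz c (p :: 'n heis) \<noteq> 0}"
    then have "\<eta> t \<noteq> 0" "trunc_horiz c p \<noteq> 0" by (auto simp: z)
    then have "\<not> b < \<bar>t\<bar>" "norm p \<le> 1 + 4 / c"
      using assms(2) trunc_horiz_support[OF assms(3), of p] by blast+
    then show "z \<in> cball 0 b \<times> cball 0 (1 + 4 / c)"
      by (simp add: z)
  qed
  then have "bounded {(t, p). \<eta> t * trunc_horiz c (p :: 'n heis) \<noteq> 0}"
    by (rule bounded_subset[rotated]) (intro bounded_Times bounded_cball)
  then show "compact (closure {z. (case z of (t, p) \<Rightarrow> \<eta> t * trunc_horiz c (p :: 'n heis)) \<noteq> 0})"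
    by (simp add: compact_closure case_prod_unfold)
qed

section \<open>The weak heat equation for truncated moments\<close>

lemma heat_kernelD:
  assumes "is_heat_kernel h"
  shows "continuous_on (- {0}) (\<lambda>(t, p). h t p)"
    and "t \<le> 0 \<Longrightarrow> h t p = 0"
    and "0 \<le> h t p"
    and "t > 0 \<Longrightarrow> integrable lborel (h t)"
    and "t > 0 \<Longrightarrow> (LINT p|lborel. h t p) = 1"
  using assms unfolding is_heat_kernel_def by blast+

lemma heat_kernel_borel_measurable:
  fixes h :: "real \<Rightarrow> ('n::finite) heis \<Rightarrow> real"
  assumes "is_heat_kernel h"
  shows "(\<lambda>(t, p). h t p) \<in> borel_measurable (lborel \<Otimes>\<^sub>M lborel)"
proof -
  have "(\<lambda>z. indicator (- {0}) z *\<^sub>R (case z of (t, p) \<Rightarrow> h t p)) \<in> borel_measurable borel"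
    by (intro borel_measurable_continuous_on_indicator heat_kernelD[OF assms]) auto
  moreover have "(\<lambda>z. indicator (- {0}) z *\<^sub>R (case z of (t, p) \<Rightarrow> h t p)) = (\<lambda>(t, p). h t p)"
    using heat_kernelD(2)[OF assms, of 0] by (auto simp: fun_eq_iff indicator_def zero_prod_def)
  ultimately show ?thesis
    by (simp add: lborel_prod)
qed

lemma heat_kernel_borel_measurable_slice:
  fixes h :: "real \<Rightarrow> ('n::finite) heis \<Rightarrow> real"
  assumes "is_heat_kernel h"
  shows "h t \<in> borel_measurable lborel"
  using measurable_Pair2[OF heat_kernel_borel_measurable[OF assms], of t] by simp

lemma heat_kernel_integrable_slice:
  assumes "is_heat_kernel h"
  shows "integrable lborel (h t)"
proof (cases "t > 0")
  case False
  then have "h t = (\<lambda>p. 0)"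
    using heat_kernelD(2)[OF assms] by auto
  then show ?thesis by simp
qed (rule heat_kernelD[OF assms])

lemma heat_kernel_integral_slice:
  assumes "is_heat_kernel h"
  shows "(LINT p|lborel. h t p) = indicator {0<..} t"
  using heat_kernelD(2,5)[OF assms] by (cases "t > 0") auto

text \<open>
A probability density integrates every bounded observable, with the same bound.
\<close>

lemma heat_kernel_integrable_mult:
  fixes h :: "real \<Rightarrow> ('n::finite) heis \<Rightarrow> real"
  assumes h: "is_heat_kernel h" and q: "continuous_on UNIV q" "\<And>p. \<bar>q p\<bar> \<le> C"
  shows "integrable lborel (\<lambda>p. h t p * q p)"
    and "\<bar>LINT p|lborel. h t p * q p\<bar> \<le> C"
proof -
  have [measurable]: "q \<in> borel_measurable lborel"
    using borel_measurable_continuous_onI[OF q(1)] by simp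
  note [measurable] = heat_kernel_borel_measurable_slice[OF h]
  have bound: "norm (h t p * q p) \<le> h t p * C" for p
    using heat_kernelD(3)[OF h] q(2) by (simp add: abs_mult mult_left_mono)
  have int: "integrable lborel (\<lambda>p. h t p * C)"
    using heat_kernel_integrable_slice[OF h] by simp
  show "integrable lborel (\<lambda>p. h t p * q p)"
  proof (rule Bochner_Integration.integrable_bound[OF int])
    show "AE p in lborel. norm (h t p * q p) \<le> norm (h t p * C)"
      by (intro AE_I2 order.trans[OF bound]) simp
  qed measurable
  have "C \<ge> 0" using q(2)[of 0] by linarith
  have "\<bar>LINT p|lborel. h t p * q p\<bar> \<le> (LINT p|lborel. h t p * C)"
    using Bochner_Integration.integral_norm_bound_integral[OF \<open>integrable lborel (\<lambda>p. h t p * q p)\<close> int] bound by simp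
  also have "\<dots> \<le> C"
    using \<open>C \<ge> 0\<close> by (simp add: heat_kernel_integral_slice[OF h] indicator_def)
  finally show "\<bar>LINT p|lborel. h t p * q p\<bar> \<le> C" .
qed

lemma heat_kernel_integrable_prod:
  fixes h :: "real \<Rightarrow> ('n::finite) heis \<Rightarrow> real"
  assumes h: "is_heat_kernel h"
    and \<eta>: "continuous_on UNIV \<eta>" "\<And>t. b < \<bar>t\<bar> \<Longrightarrow> \<eta> t = 0"
    and q: "continuous_on UNIV q" "\<And>p. \<bar>q p\<bar> \<le> C"
  shows "integrable (lborel \<Otimes>\<^sub>M lborel) (\<lambda>(t, p). \<eta> t * (h t p * q p))"
proof (rule lborel_pair.Fubini_integrable)
  note [measurable] = heat_kernel_borel_measurable[OF h]
  have [measurable]: "q \<in> borel_measurable lborel" "\<eta> \<in> borel_measurable lborel"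
    using borel_measurable_continuous_onI[OF q(1)] borel_measurable_continuous_onI[OF \<eta>(1)] by auto
  show meas: "(\<lambda>(t, p). \<eta> t * (h t p * q p)) \<in> borel_measurable (lborel \<Otimes>\<^sub>M lborel)"
    by measurable
  note int = heat_kernel_integrable_mult[OF h q]
  show "AE t in lborel. integrable lborel (\<lambda>p. case (t, p) of (t, p) \<Rightarrow> \<eta> t * (h t p * q p))"
    using int(1) by simp
  have int_abs: "\<bar>LINT p|lborel. h t p * \<bar>q p\<bar>\<bar> \<le> C" for t
    using q by (intro heat_kernel_integrable_mult[OF h]) (auto intro: continuous_intros)
  have eq: "(LINT p|lborel. norm (case (t, p) of (t, p) \<Rightarrow> \<eta> t * (h t p * q p))) =
      \<bar>\<eta> t\<bar> * (LINT p|lborel. h t p * \<bar>q p\<bar>)" for t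
    using heat_kernelD(3)[OF h] by (simp add: abs_mult)
  have "integrable lborel (\<lambda>t. indicator {-b..b} t *\<^sub>R (\<bar>\<eta> t\<bar> * C))"
    by (intro borel_integrable_compact continuous_intros continuous_on_subset[OF \<eta>(1)]) auto
  then show "integrable lborel
      (\<lambda>t. LINT p|lborel. norm (case (t, p) of (t, p) \<Rightarrow> \<eta> t * (h t p * q p)))"
  proof (rule Bochner_Integration.integrable_bound)
    show "(\<lambda>t. LINT p|lborel. norm (case (t, p) of (t, p) \<Rightarrow> \<eta> t * (h t p * q p)))
        \<in> borel_measurable lborel"
      by measurable
    show "AE t in lborel. norm (LINT p|lborel. norm (case (t, p) of (t, p) \<Rightarrow> \<eta> t * (h t p * q p)))
        \<le> norm (indicator {-b..b} t *\<^sub>R (\<bar>\<eta> t\<bar> * C))"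
    proof (rule AE_I2)
      fix t
      have "C \<ge> 0" using q(2)[of 0] by linarith
      have "t \<in> {-b..b}" if "\<eta> t \<noteq> 0"
        using \<eta>(2)[of t] that by (cases "b < \<bar>t\<bar>") auto
      then show "norm (LINT p|lborel. norm (case (t, p) of (t, p) \<Rightarrow> \<eta> t * (h t p * q p)))
          \<le> norm (indicator {-b..b} t *\<^sub>R (\<bar>\<eta> t\<bar> * C))"
        using int_abs[of t] \<open>C \<ge> 0\<close> unfolding eq
        by (cases "\<eta> t = 0") (auto simp: abs_mult intro: mult_left_mono)
    qed
  qed
qed

lemma heat_kernel_integral_prod:
  fixes h :: "real \<Rightarrow> ('n::finite) heis \<Rightarrow> real"
  assumes h: "is_heat_kernel h"
    and \<eta>: "continuous_on UNIV \<eta>" "\<And>t. b < \<bar>t\<bar> \<Longrightarrow> \<eta> t = 0"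
    and q: "continuous_on UNIV q" "\<And>p. \<bar>q p\<bar> \<le> C"
  shows "(LINT (t, p)|(lborel \<Otimes>\<^sub>M lborel). \<eta> t * (h t p * q p)) =
    (LINT t|lborel. \<eta> t * (LINT p|lborel. h t p * q p))"
  using lborel_pair.integral_fst'[OF heat_kernel_integrable_prod[OF assms]] by simp

lemma trunc_horiz_abs_le: "c > 0 \<Longrightarrow> \<bar>trunc_horiz c p\<bar> \<le> 2 / c"
  using trunc_horiz_bounds(1)[of c p] trunc_horiz_bounded[of c p] by simp

text \<open>
The distributional equation tested against \<open>\<eta> t * trunc_horiz c p\<close>. The Dirac mass contributes nothing
because the truncated square norm vanishes at the origin.
\<close>

lemma weak_truncated_moment_equation:
  fixes h :: "real \<Rightarrow> ('n::finite) heis \<Rightarrow> real"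
  assumes h: "is_heat_kernel h" and "c > 0"
    and \<eta>: "smooth \<eta>" "\<And>t. b < \<bar>t\<bar> \<Longrightarrow> \<eta> t = 0"
  shows "(LINT t|lborel. - deriv \<eta> t * (LINT p|lborel. h t p * trunc_horiz c p)) =
    (LINT t|lborel. \<eta> t * (LINT p|lborel. h t p * trunc_density c p))"
proof -
  obtain C where C: "\<And>c. \<And>p :: 'n heis. \<bar>trunc_density c p\<bar> \<le> C"
    using trunc_density_bounded by blast
  have d\<eta>: "continuous_on UNIV (\<lambda>t. - deriv \<eta> t)" "\<And>t. b < \<bar>t\<bar> \<Longrightarrow> - deriv \<eta> t = 0"
    using smooth_continuous_on[OF smooth_deriv[OF \<eta>(1)]] deriv_eq_0_outside[OF \<eta>(2)]
    by (auto intro: continuous_on_minus)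
  note args1 = h d\<eta> continuous_on_trunc_horiz trunc_horiz_abs_le[OF \<open>c > 0\<close>]
    and args2 = h smooth_continuous_on[OF \<eta>(1)] \<eta>(2) continuous_on_trunc_density C
  have "(LINT (t, p)|lborel. h t p * (- deriv (\<lambda>\<tau>. (case (\<tau>, p) of (t, p) \<Rightarrow> \<eta> t * trunc_horiz c p)) t
      + sublaplacian (\<lambda>q. case (t, q) of (t, p) \<Rightarrow> \<eta> t * trunc_horiz c p) p)) =
      (case 0 of (t, p) \<Rightarrow> \<eta> t * trunc_horiz c (p :: 'n heis))"
    using h test_function_trunc_horiz[OF \<eta> \<open>c > 0\<close>]
    unfolding is_heat_kernel_def heat_fundamental_solution_def by blast
  moreover have "h t p * (- deriv (\<lambda>\<tau>. (case (\<tau>, p) of (t, p) \<Rightarrow> \<eta> t * trunc_horiz c p)) t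
      + sublaplacian (\<lambda>q. case (t, q) of (t, p) \<Rightarrow> \<eta> t * trunc_horiz c p) p) =
      - deriv \<eta> t * (h t p * trunc_horiz c p) - \<eta> t * (h t p * trunc_density c p)" for t and p :: "'n heis"
  proof -
    have deriv: "deriv (\<lambda>\<tau>. \<eta> \<tau> * trunc_horiz c p) t = deriv \<eta> t * trunc_horiz c p"
      by (rule DERIV_imp_deriv[OF DERIV_cmult_right[OF smooth_has_real_derivative[OF \<eta>(1)]]])
    have lap: "sublaplacian (\<lambda>q. \<eta> t * trunc_horiz c q) p = - (\<eta> t * trunc_density c p)"
      using \<open>c > 0\<close> by (intro sublaplacian_trunc_horiz) simp
    show ?thesis
      unfolding prod.case deriv lap by (simp add: algebra_simps)
  qed
  moreover have "(case 0 of (t, p) \<Rightarrow> \<eta> t * trunc_horiz c (p :: 'n heis)) = 0"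
    by (simp add: trunc_horiz_def horiz_eq_inner zero_prod_def)
  ultimately have "(LINT (t, p)|lborel. - deriv \<eta> t * (h t p * trunc_horiz c p)
      - \<eta> t * (h t p * trunc_density c p)) = 0"
    by (simp only:)
  then have "(LINT (t, p)|(lborel \<Otimes>\<^sub>M lborel). - deriv \<eta> t * (h t p * trunc_horiz c p)) -
      (LINT (t, p)|(lborel \<Otimes>\<^sub>M lborel). \<eta> t * (h t p * trunc_density c p)) = 0"
    using Bochner_Integration.integral_diff[OF heat_kernel_integrable_prod[OF args1]
        heat_kernel_integrable_prod[OF args2]]
    by (simp add: lborel_prod case_prod_unfold)
  then show ?thesis
    using heat_kernel_integral_prod[OF args1] heat_kernel_integral_prod[OF args2] by simp
qed

section \<open>Truncated moments as integrals of their rate\<close>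

text \<open>
The distributional equation determines moments only for almost every time; continuity of the kernel
away from the origin of space-time gives them a meaning at each positive time. The truncation restricts
the integral to a compact set of space, and times near \<open>t > 0\<close> stay away from the singularity, so the
kernel is bounded there.
\<close>

lemma heat_kernel_moment_tendsto:
  fixes h :: "real \<Rightarrow> ('n::finite) heis \<Rightarrow> real"
  assumes h: "is_heat_kernel h" and "c > 0" and s: "s \<longlonglongrightarrow> t" "t > 0"
  shows "(\<lambda>k. LINT p|lborel. h (s k) p * trunc_horiz c p) \<longlonglongrightarrow>
    (LINT p|lborel. h t p * trunc_horiz c p)"
proof -
  define K where "K = cball (0 :: 'n heis) (1 + 4 / c)"
  \<comment> \<open>A compact neighbourhood of \<open>t\<close> in the positive half-line.\<close>
  define J where "J = {t / 2..2 * t}"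
  have cont: "continuous_on (J \<times> K) (\<lambda>(t, p). h t p)"
    by (rule continuous_on_subset[OF heat_kernelD(1)[OF h]])
      (use \<open>t > 0\<close> in \<open>auto simp: J_def zero_prod_def\<close>)
  have "compact (J \<times> K)"
    unfolding J_def K_def by (intro compact_Times compact_Icc compact_cball)
  then have "bounded ((\<lambda>(t, p). h t p) ` (J \<times> K))"
    using compact_continuous_image[OF cont] compact_imp_bounded by blast
  then obtain B where B: "\<And>t p. t \<in> J \<Longrightarrow> p \<in> K \<Longrightarrow> \<bar>h t p\<bar> \<le> B"
    unfolding bounded_iff by fastforce
  have supp: "trunc_horiz c p = 0" if "p \<notin> K" for p
    using trunc_horiz_support[OF \<open>c > 0\<close>, of p] that by (auto simp: K_def)
  have "eventually (\<lambda>k. s k \<in> {t / 2<..<2 * t}) sequentially"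
    using s by (intro topological_tendstoD) auto
  then obtain N where N: "\<And>k. k \<ge> N \<Longrightarrow> s k \<in> J"
    unfolding eventually_sequentially J_def by (metis greaterThanLessThan_subseteq_atLeastAtMost_iff order_refl subsetD)
  have meas[measurable]: "trunc_horiz c \<in> borel_measurable (lborel :: 'n heis measure)"
    using borel_measurable_continuous_onI[OF continuous_on_trunc_horiz] by simp
  note [measurable] = heat_kernel_borel_measurable_slice[OF h]
  have "(\<lambda>k. LINT p|lborel. h (s (k + N)) p * trunc_horiz c p) \<longlonglongrightarrow>
    (LINT p|lborel. h t p * trunc_horiz c p)"
  proof (rule integral_dominated_convergence)
    show "integrable lborel (\<lambda>p. indicator K p *\<^sub>R (B * (2 / c)))"
      unfolding K_def by (intro borel_integrable_compact continuous_intros) auto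
    show "AE p in lborel. norm (h (s (k + N)) p * trunc_horiz c p) \<le> indicator K p *\<^sub>R (B * (2 / c))"
      for k
    proof (rule AE_I2)
      fix p
      show "norm (h (s (k + N)) p * trunc_horiz c p) \<le> indicator K p *\<^sub>R (B * (2 / c))"
      proof (cases "p \<in> K")
        case True
        then show ?thesis
          using mult_mono[OF B[OF N[of "k + N"], of p] trunc_horiz_abs_le[OF \<open>c > 0\<close>, of p]]
            order.trans[OF abs_ge_zero B[OF N[of "k + N"], of p]] by (simp add: abs_mult)
      qed (simp add: supp)
    qed
    show "AE p in lborel. (\<lambda>k. h (s (k + N)) p * trunc_horiz c p) \<longlonglongrightarrow> h t p * trunc_horiz c p"
    proof (rule AE_I2, intro tendsto_mult tendsto_const)
      fix p
      have "isCont (\<lambda>(t, p). h t p) (t, p)"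
        using heat_kernelD(1)[OF h] \<open>t > 0\<close>
        by (subst (asm) continuous_on_eq_continuous_at) (auto simp: zero_prod_def)
      moreover have "(\<lambda>k. (s (k + N), p)) \<longlonglongrightarrow> (t, p)"
        using LIMSEQ_ignore_initial_segment[OF s(1)] by (intro tendsto_intros)
      ultimately show "(\<lambda>k. h (s (k + N)) p) \<longlonglongrightarrow> h t p"
        using isCont_tendsto_compose by fastforce
    qed
  qed measurable
  then show ?thesis
    by (rule LIMSEQ_offset)
qed

lemma smooth_step_derivative_integral:
  shows "deriv smooth_step w \<noteq> 0 \<Longrightarrow> w \<in> {0..1}"
    and "integrable lborel (deriv smooth_step)"
    and "(LINT w|lborel. deriv smooth_step w) = 1"
proof -
  show supp: "w \<in> {0..1}" if "deriv smooth_step w \<noteq> 0" for w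
  proof (rule ccontr)
    assume "w \<notin> {0..1}"
    then consider "w < 0" | "w > 1" by fastforce
    then have "deriv smooth_step w = 0"
    proof cases
      case 1
      then have "eventually (\<lambda>y. smooth_step y = 0) (nhds w)"
        using eventually_nhds_in_open[of "{..<0}" w]
        by (auto elim!: eventually_mono simp: smooth_step_eq_0)
      then show ?thesis by (subst deriv_cong_ev[where g = "\<lambda>_. 0"]) auto
    next
      case 2
      then have "eventually (\<lambda>y. smooth_step y = 1) (nhds w)"
        using eventually_nhds_in_open[of "{1<..}" w]
        by (auto elim!: eventually_mono simp: smooth_step_eq_1)
      then show ?thesis by (subst deriv_cong_ev[where g = "\<lambda>_. 1"]) auto
    qed
    then show False using that by simp
  qed
  have "has_bochner_integral lborel (\<lambda>w. deriv smooth_step w * indicator {0..1} w)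
      (smooth_step 1 - smooth_step 0)"
    by (rule has_bochner_integral_FTC_Icc_real)
      (auto intro: smooth_has_real_derivative isCont_smooth_real smooth_deriv smooth_smooth_step)
  moreover have "(\<lambda>w. deriv smooth_step w * indicator {0..1} w) = deriv smooth_step"
    using supp by (force simp: indicator_def)
  ultimately have "has_bochner_integral lborel (deriv smooth_step) 1"
    by (simp add: smooth_step_eq_0 smooth_step_eq_1)
  then show "integrable lborel (deriv smooth_step)" "(LINT w|lborel. deriv smooth_step w) = 1"
    by (auto simp: has_bochner_integral_iff)
qed

text \<open>
A smooth approximation of the indicator of \<open>(0, 1]\<close> at positive times: it falls from \<open>1\<close> to \<open>0\<close> on
\<open>[1, 1 + 1/m]\<close>. The first factor only serves to make the support compact; it is \<open>1\<close> on all positive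
times, and the kernel vanishes at the others.
\<close>

definition time_step :: "real \<Rightarrow> real \<Rightarrow> real" where
  "time_step m t = smooth_step (t + 2) * smooth_step (m * (1 - t) + 1)"

lemma smooth_time_step: "smooth (time_step m)"
proof (rule smoothI)
  fix k
  have "C_k k (\<lambda>t :: real. t + 2)" "C_k k (\<lambda>t :: real. (- m) * t + (m + 1))"
    by (intro C_k_add C_k_mult C_k_const C_k_bounded_linear bounded_linear_ident)+
  moreover have "(\<lambda>t :: real. (- m) * t + (m + 1)) = (\<lambda>t. m * (1 - t) + 1)"
    by (auto simp: algebra_simps)
  ultimately show "C_k k (time_step m)"
    unfolding time_step_def by (intro C_k_mult C_k_compose[OF smooth_smooth_step]) simp_all
qed

lemma time_step_eq_0:
  assumes "m \<ge> 1" "2 < \<bar>t\<bar>"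
  shows "time_step m t = 0"
proof (cases "t < 0")
  case True
  then show ?thesis using assms by (simp add: time_step_def smooth_step_eq_0)
next
  case False
  then have "1 \<le> m * (t - 1)" using assms mult_mono[of 1 m 1 "t - 1"] by simp
  then have "m * (1 - t) + 1 \<le> 0" by (simp add: algebra_simps)
  then show ?thesis by (simp add: time_step_def smooth_step_eq_0)
qed

lemma time_step_eq: "t > 0 \<Longrightarrow> time_step m t = smooth_step (m * (1 - t) + 1)"
  by (simp add: time_step_def smooth_step_eq_1)

lemma deriv_time_step:
  assumes "t > 0"
  shows "deriv (time_step m) t = - (m * deriv smooth_step (m * (1 - t) + 1))"
proof -
  have "eventually (\<lambda>y. time_step m y = smooth_step (m * (1 - y) + 1)) (nhds t)"
    using eventually_nhds_in_open[of "{0<..}" t] assms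
    by (auto elim!: eventually_mono simp: time_step_eq)
  then have "deriv (time_step m) t = deriv (\<lambda>y. smooth_step (m * (1 - y) + 1)) t"
    by (rule deriv_cong_ev) simp
  also have "\<dots> = - (m * deriv smooth_step (m * (1 - t) + 1))"
  proof (rule DERIV_imp_deriv)
    have "((\<lambda>y. m * (1 - y) + 1) has_real_derivative - m) (at t)"
      by (auto intro!: derivative_eq_intros)
    from DERIV_chain2[OF smooth_has_real_derivative[OF smooth_smooth_step] this]
    show "((\<lambda>y. smooth_step (m * (1 - y) + 1)) has_real_derivative
        - (m * deriv smooth_step (m * (1 - t) + 1))) (at t)"
      by (simp add: mult.commute)
  qed
  finally show ?thesis .
qed

lemma time_step_tendsto:
  assumes "t > 0"
  shows "(\<lambda>k. time_step (real (Suc k)) t) \<longlonglongrightarrow> indicator {0<..1} t"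
proof (cases "t \<le> 1")
  case True
  then have "time_step (real (Suc k)) t = 1" for k
    using assms by (simp add: time_step_eq smooth_step_eq_1)
  then show ?thesis using True assms by simp
next
  case False
  then obtain N :: nat where N: "1 / (t - 1) < real N"
    using reals_Archimedean2 by blast
  have "time_step (real (Suc k)) t = 0" if "k \<ge> N" for k
  proof -
    have "1 / (t - 1) \<le> real (Suc k)" using N that by linarith
    then have "1 \<le> real (Suc k) * (t - 1)" using False by (simp add: pos_divide_le_eq)
    then have "real (Suc k) * (1 - t) + 1 \<le> 0" by (simp add: algebra_simps)
    then show ?thesis using assms by (simp only: time_step_eq smooth_step_eq_0)
  qed
  then have "eventually (\<lambda>k. time_step (real (Suc k)) t = 0) sequentially"
    unfolding eventually_sequentially by blast
  then show ?thesis using False by (simp add: tendsto_eventually)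
qed

lemma time_step_abs_le_1: "\<bar>time_step m t\<bar> \<le> 1"
  by (simp add: time_step_def smooth_step_nonneg smooth_step_le_1 mult_le_one)

text \<open>
The integrated form of the statement that the truncated moment has time derivative given by
\<open>trunc_density\<close> and starts from \<open>0\<close>. It is obtained from the weak equation with \<open>\<eta> = time_step m\<close> as
\<open>m\<close> tends to infinity: \<open>- deriv \<eta>\<close> tends to the Dirac mass at time \<open>1\<close> and \<open>\<eta>\<close> itself to the indicator
of \<open>(0, 1]\<close>.
\<close>

lemma truncated_moment_eq:
  fixes h :: "real \<Rightarrow> ('n::finite) heis \<Rightarrow> real"
  assumes h: "is_heat_kernel h" and "c > 0"
  shows "(LINT p|lborel. h 1 p * trunc_horiz c p) =
    (LINT t|lborel. indicator {0<..1} t * (LINT p|lborel. h t p * trunc_density c p))"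
proof (rule LIMSEQ_unique)
  obtain C where C: "C \<ge> 0" "\<And>c. \<And>p :: 'n heis. \<bar>trunc_density c p\<bar> \<le> C"
    using trunc_density_bounded by blast
  define u where "u t = (LINT p|lborel. h t p * trunc_horiz c p)" for t
  define g where "g t = (LINT p|lborel. h t p * trunc_density c p)" for t
  note [measurable] = heat_kernel_borel_measurable[OF h]
  have [measurable]: "trunc_horiz c \<in> borel_measurable (lborel :: 'n heis measure)"
    "trunc_density c \<in> borel_measurable (lborel :: 'n heis measure)"
    "deriv smooth_step \<in> borel_measurable borel" "time_step m \<in> borel_measurable borel" for m
    using borel_measurable_continuous_onI[OF continuous_on_trunc_horiz]
      borel_measurable_continuous_onI[OF continuous_on_trunc_density]
      borel_measurable_continuous_onI[OF smooth_continuous_on[OF smooth_deriv[OF smooth_smooth_step]]]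
      borel_measurable_continuous_onI[OF smooth_continuous_on[OF smooth_time_step]] by auto
  have [measurable]: "u \<in> borel_measurable borel" "g \<in> borel_measurable borel"
    unfolding u_def[abs_def] g_def[abs_def]
    by (subst measurable_lborel1[symmetric], measurable)+
  have u_bound: "\<bar>u t\<bar> \<le> 2 / c" for t
    unfolding u_def
    by (rule heat_kernel_integrable_mult[OF h continuous_on_trunc_horiz trunc_horiz_abs_le[OF \<open>c > 0\<close>]])
  have g_bound: "\<bar>g t\<bar> \<le> C" for t
    unfolding g_def by (rule heat_kernel_integrable_mult[OF h continuous_on_trunc_density C(2)])
  have u0: "u t = 0" and g0: "g t = 0" if "t \<le> 0" for t
    using heat_kernelD(2)[OF h that] by (simp_all add: u_def g_def)
  define I where "I k = (LINT t|lborel. time_step (real (Suc k)) t * g t)" for k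
  \<comment> \<open>Rescaling by \<open>t = 1 + (1 - w) / m\<close> turns the concentrating kernel into a fixed probability density.\<close>
  have I_eq: "I k = (LINT w|lborel. deriv smooth_step w * u (1 + (1 - w) / real (Suc k)))" for k
  proof -
    let ?m = "real (Suc k)"
    have "I k = (LINT t|lborel. - deriv (time_step ?m) t * u t)"
      unfolding I_def u_def g_def
      by (rule weak_truncated_moment_equation[OF h \<open>c > 0\<close> smooth_time_step time_step_eq_0, symmetric]) simp_all
    also have "\<dots> = (LINT t|lborel. ?m * deriv smooth_step (?m * (1 - t) + 1) * u t)"
    proof (rule Bochner_Integration.integral_cong[OF refl])
      fix t
      show "- deriv (time_step ?m) t * u t = ?m * deriv smooth_step (?m * (1 - t) + 1) * u t"
        by (cases "t > 0") (simp_all add: deriv_time_step u0)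
    qed
    also have "\<dots> = \<bar>- (1 / ?m)\<bar> *\<^sub>R (LINT w|lborel.
        ?m * deriv smooth_step (?m * (1 - ((1 + 1 / ?m) + - (1 / ?m) * w)) + 1)
          * u ((1 + 1 / ?m) + - (1 / ?m) * w))"
      by (rule lborel_integral_real_affine) simp
    also have "\<dots> = (LINT w|lborel. deriv smooth_step w * u (1 + (1 - w) / ?m))"
    proof -
      have "m * (1 - ((1 + 1 / m) + - (1 / m) * w)) + 1 = w"
        "(1 + 1 / m) + - (1 / m) * w = 1 + (1 - w) / m" if "m > 0" for m w :: real
        using that by (simp_all add: field_simps)
      note eqs = this[of ?m]
      show ?thesis
        unfolding eqs[OF of_nat_0_less_iff[THEN iffD2, OF zero_less_Suc]] by (simp add: mult.assoc)
    qed
    finally show ?thesis .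
  qed
  show "I \<longlonglongrightarrow> (LINT t|lborel. indicator {0<..1} t * (LINT p|lborel. h t p * trunc_density c p))"
    unfolding I_def g_def[symmetric]
  proof (rule integral_dominated_convergence)
    show "integrable lborel (\<lambda>t :: real. indicator {0..2} t *\<^sub>R C)"
      by (intro borel_integrable_compact continuous_intros) auto
    show "AE t in lborel. (\<lambda>k. time_step (real (Suc k)) t * g t) \<longlonglongrightarrow> indicator {0<..1} t * g t"
    proof (rule AE_I2)
      fix t
      show "(\<lambda>k. time_step (real (Suc k)) t * g t) \<longlonglongrightarrow> indicator {0<..1} t * g t"
        using tendsto_mult[OF time_step_tendsto[of t] tendsto_const[of "g t"]]
        by (cases "t > 0") (simp_all only: g0 not_less mult_zero_right tendsto_const)
    qed
    show "AE t in lborel. norm (time_step (real (Suc k)) t * g t) \<le> indicator {0..2} t *\<^sub>R C" for k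
    proof (rule AE_I2)
      fix t
      show "norm (time_step (real (Suc k)) t * g t) \<le> indicator {0..2} t *\<^sub>R C"
      proof (cases "t \<in> {0..2}")
        case True
        have "\<bar>time_step (real (Suc k)) t\<bar> * \<bar>g t\<bar> \<le> 1 * C"
          by (intro mult_mono time_step_abs_le_1 g_bound) auto
        then show ?thesis
          using True by (simp add: abs_mult)
      next
        case False
        then show ?thesis
          using g0[of t] time_step_eq_0[of "real (Suc k)" t] by auto
      qed
    qed
  qed measurable
  show "I \<longlonglongrightarrow> (LINT p|lborel. h 1 p * trunc_horiz c p)"
  proof -
    have "(\<lambda>k. LINT w|lborel. deriv smooth_step w * u (1 + (1 - w) / real (Suc k))) \<longlonglongrightarrow>
        (LINT w|lborel. deriv smooth_step w * u 1)"
    proof (rule integral_dominated_convergence)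
      show "integrable lborel (\<lambda>w. \<bar>deriv smooth_step w\<bar> * (2 / c))"
        using smooth_step_derivative_integral(2) by simp
      show "AE w in lborel. (\<lambda>k. deriv smooth_step w * u (1 + (1 - w) / real (Suc k)))
          \<longlonglongrightarrow> deriv smooth_step w * u 1"
      proof (rule AE_I2, rule tendsto_mult[OF tendsto_const])
        fix w :: real
        have "(\<lambda>k. 1 + (1 - w) * inverse (real (Suc k))) \<longlonglongrightarrow> 1 + (1 - w) * 0"
          by (intro tendsto_intros LIMSEQ_inverse_real_of_nat)
        then show "(\<lambda>k. u (1 + (1 - w) / real (Suc k))) \<longlonglongrightarrow> u 1"
          unfolding u_def
          by (intro heat_kernel_moment_tendsto[OF h \<open>c > 0\<close>]) (simp_all add: divide_inverse)
      qed
      show "AE w in lborel. norm (deriv smooth_step w * u (1 + (1 - w) / real (Suc k)))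
          \<le> \<bar>deriv smooth_step w\<bar> * (2 / c)" for k
        unfolding real_norm_def abs_mult by (intro AE_I2 mult_left_mono u_bound) simp
    qed measurable
    then show ?thesis
      unfolding I_eq[abs_def] u_def[symmetric] by (simp add: smooth_step_derivative_integral(3))
  qed
qed

section \<open>The second moment\<close>

theorem proposition6p1:
  fixes h :: "real \<Rightarrow> ('n::finite) heis \<Rightarrow> real"
  assumes "is_heat_kernel h"
  shows "(LINT p|lborel. (norm (proj_H1 p))\<^sup>2 * h 1 p) = 4 * real CARD('n)"
proof -
  note h = assms
  define c where "c k = inverse (real (Suc k))" for k
  have c_pos: "c k > 0" for k by (simp add: c_def)
  have c_lim: "c \<longlonglongrightarrow> 0" unfolding c_def by (rule LIMSEQ_inverse_real_of_nat)
  obtain C where C: "C \<ge> 0" "\<And>c. \<And>p :: 'n heis. \<bar>trunc_density c p\<bar> \<le> C"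
    using trunc_density_bounded by blast
  note [measurable] = heat_kernel_borel_measurable[OF h] heat_kernel_borel_measurable_slice[OF h]
  have [measurable]: "trunc_density c \<in> borel_measurable (lborel :: 'n heis measure)"
    "horiz \<in> borel_measurable (lborel :: 'n heis measure)" for c
    using borel_measurable_continuous_onI[OF continuous_on_trunc_density]
      borel_measurable_continuous_onI[OF continuous_on_horiz] by auto
  \<comment> \<open>At each fixed time the rate of the truncated moment tends to the constant \<open>4n\<close> as the truncation is removed.\<close>
  have rate: "(\<lambda>k. LINT p|lborel. h t p * trunc_density (c k) p) \<longlonglongrightarrow> 4 * real CARD('n)"
    if "t > 0" for t
  proof -
    have "(\<lambda>k. LINT p|lborel. h t p * trunc_density (c k) p) \<longlonglongrightarrow>
        (LINT p|lborel. h t p * (4 * real CARD('n)))"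
    proof (rule integral_dominated_convergence)
      show "integrable lborel (\<lambda>p. h t p * C)"
        using heat_kernelD(4)[OF h that] by simp
      show "AE p in lborel. norm (h t p * trunc_density (c k) p) \<le> h t p * C" for k
        using C heat_kernelD(3)[OF h] by (intro AE_I2) (simp add: abs_mult mult_left_mono)
    qed (auto intro!: tendsto_mult trunc_density_tendsto c_lim)
    then show ?thesis
      using heat_kernelD(5)[OF h that] by simp
  qed
  have "(\<lambda>k. LINT t|lborel. indicator {0<..1} t * (LINT p|lborel. h t p * trunc_density (c k) p))
      \<longlonglongrightarrow> (LINT t|lborel. indicator {0<..1 :: real} t * (4 * real CARD('n)))"
  proof (rule integral_dominated_convergence)
    show "integrable lborel (\<lambda>t :: real. indicator {0..1} t *\<^sub>R C)"
      by (intro borel_integrable_compact continuous_intros) auto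
    show "AE t in lborel. (\<lambda>k. indicator {0<..1} t * (LINT p|lborel. h t p * trunc_density (c k) p))
        \<longlonglongrightarrow> indicator {0<..1} t * (4 * real CARD('n))"
    proof (rule AE_I2)
      fix t :: real
      show "(\<lambda>k. indicator {0<..1} t * (LINT p|lborel. h t p * trunc_density (c k) p))
        \<longlonglongrightarrow> indicator {0<..1} t * (4 * real CARD('n))"
        using rate[of t] by (cases "t > 0") (auto intro!: tendsto_mult)
    qed
    show "AE t in lborel. norm (indicator {0<..1} t * (LINT p|lborel. h t p * trunc_density (c k) p))
        \<le> indicator {0..1} t *\<^sub>R C" for k
      using heat_kernel_integrable_mult(2)[OF h continuous_on_trunc_density C(2)] C(1)
      by (intro AE_I2) (auto simp: indicator_def)
  qed measurable
  then have lim: "(\<lambda>k. LINT p|lborel. h 1 p * trunc_horiz (c k) p) \<longlonglongrightarrow> 4 * real CARD('n)"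
    by (simp add: truncated_moment_eq[OF h c_pos])
  \<comment> \<open>Finiteness of the full moment is not known beforehand; monotone convergence yields it with the value.\<close>
  have "(LINT p|lborel. h 1 p * horiz p) = 4 * real CARD('n)"
  proof (rule integral_monotone_convergence[OF _ _ _ lim])
    show "integrable lborel (\<lambda>p. h 1 p * trunc_horiz (c k) p)" for k
      by (rule heat_kernel_integrable_mult[OF h continuous_on_trunc_horiz
            trunc_horiz_abs_le[OF c_pos]])
    have "h 1 p * trunc_horiz (c i) p \<le> h 1 p * trunc_horiz (c j) p" if "i \<le> j" for i j p
      using that c_pos
      by (intro mult_left_mono trunc_horiz_mono heat_kernelD(3)[OF h]) (auto simp: c_def)
    then show "AE p in lborel. mono (\<lambda>k. h 1 p * trunc_horiz (c k) p)"
      by (intro AE_I2 monoI)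
    show "AE p in lborel. (\<lambda>k. h 1 p * trunc_horiz (c k) p) \<longlonglongrightarrow> h 1 p * horiz p"
      by (intro AE_I2 tendsto_mult tendsto_const trunc_horiz_tendsto c_lim)
  qed measurable
  then show ?thesis
    by (simp add: horiz_def mult.commute)
qed

end
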